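(* Fix $\epsilon\in(0,1)$. Let $h$ be any function such that $h(n)\to\infty$ as $n\to\infty$. For any hereditary graph class $\mathcal{G}$ such that $\mathrm{sep}(G)\le c\,n^{1-\epsilon}$ for every $n$-vertex $G\in\mathcal{G}$, for some constant $c>0$, every $n$-vertex graph $G\in\mathcal{G}$ is contained in $H\boxtimes K_m$ for some graph $H$ with $\mathrm{td}(H)\le\lceil h(n)\rceil$, where $m\le\frac{c\,2^\epsilon}{2^\epsilon-1}\,n^{1-\epsilon+\delta(n)}$ and $\delta(n):=(1-\epsilon)\big((1-\epsilon^{h(n)})^{-1}-1\big)$.
   Context: A graph class is hereditary if closed under isomorphism and induced subgraphs. $\mathrm{sep}(G)$ is the minimum size of a set $S\subseteq V(G)$ such that each component of $G-S$ has at most $|V(G)|/2$ vertices. The tree-depth $\mathrm{td}(H)$ is the minimum number of vertices on a longest root-to-leaf path of a rooted forest $F$ such that $H$ is a subgraph of the closure of $F$ (ancestor–descendant pairs joined). The strong product $A\boxtimes B$ has vertex set $V(A)\times V(B)$, with distinct $(v,x),(w,y)$ adjacent iff ($v=w$ and $xy\in E(B)$) or ($x=y$ and $vw\in E(A)$) or ($vw\in E(A)$ and $xy\in E(B)$). Contained means isomorphic to a subgraph.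
   Formalization: The claim is made only for those n with h(n) > 0; if h(n) = 0 then δ(n) is undefined, and if h(n) < 0 then td(H) ≤ ⌈h(n)⌉ ≤ 0 fails for every nonempty G. *)

theory Defs
  imports Complex_Main "Graph_Theory.Graph_Theory"
begin

text \<open>
  Finite simple graphs are the \<^locale>\<open>pair_graph\<close>s of the Graph Theory library, that is, finite
  loop-free symmetric digraphs whose arcs are pairs of vertices. The null graph is allowed.
  For a symmetric digraph the strongly connected components (\<^const>\<open>pre_digraph.sccs\<close>) are the
  connected components of the undirected graph.
\<close>

definition hereditary :: "'a pair_pre_digraph set \<Rightarrow> bool" where
  "hereditary \<G> \<longleftrightarrow>
     (\<forall>G\<in>\<G>. pair_graph G) \<and>
     (\<forall>G\<in>\<G>. \<forall>G'. digraph_iso (with_proj G) (with_proj G') \<longrightarrow> G' \<in> \<G>) \<and>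
     (\<forall>G\<in>\<G>. \<forall>G'. induced_subgraph (with_proj G') (with_proj G) \<longrightarrow> G' \<in> \<G>)"

definition balanced_separator :: "'a pair_pre_digraph \<Rightarrow> 'a set \<Rightarrow> bool" where
  "balanced_separator G S \<longleftrightarrow> S \<subseteq> pverts G \<and>
     (\<forall>C \<in> pre_digraph.sccs (induce_subgraph (with_proj G) (pverts G - S)).
        real (card (verts C)) \<le> real (card (pverts G)) / 2)"

definition sep :: "'a pair_pre_digraph \<Rightarrow> nat" where
  "sep G = (LEAST k. \<exists>S. balanced_separator G S \<and> card S = k)"

text \<open>
  A rooted forest is a digraph with arcs directed from parents to children: there are no directed
  cycles (\<^const>\<open>forest\<close> of a digraph) and each vertex has at most one parent.
  Roots have in-degree 0 and leaves have out-degree 0.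
\<close>

definition rooted_forest :: "'a pair_pre_digraph \<Rightarrow> bool" where
  "rooted_forest F \<longleftrightarrow> pair_digraph F \<and> forest (with_proj F) \<and>
     (\<forall>v\<in>pverts F. in_degree (with_proj F) v \<le> 1)"

definition root_leaf_path :: "'a pair_pre_digraph \<Rightarrow> 'a list \<Rightarrow> bool" where
  "root_leaf_path F p \<longleftrightarrow> vpath p (with_proj F) \<and>
     in_degree (with_proj F) (hd p) = 0 \<and> out_degree (with_proj F) (last p) = 0"

text \<open>The element 0 is inserted only to give the empty forest height 0.\<close>

definition forest_height :: "'a pair_pre_digraph \<Rightarrow> nat" where
  "forest_height F = Max (insert 0 (length ` {p. root_leaf_path F p}))"

definition forest_closure :: "'a pair_pre_digraph \<Rightarrow> 'a pair_pre_digraph" where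
  "forest_closure F = \<lparr> pverts = pverts F,
     parcs = {(u, v). u \<rightarrow>\<^sup>+\<^bsub>with_proj F\<^esub> v \<or> v \<rightarrow>\<^sup>+\<^bsub>with_proj F\<^esub> u} \<rparr>"

definition tree_depth :: "'a pair_pre_digraph \<Rightarrow> nat" where
  "tree_depth H = (LEAST d. \<exists>F. rooted_forest F \<and>
     subgraph (with_proj H) (with_proj (forest_closure F)) \<and> forest_height F = d)"

definition strong_product ::
    "'a pair_pre_digraph \<Rightarrow> 'b pair_pre_digraph \<Rightarrow> ('a \<times> 'b) pair_pre_digraph" where
  "strong_product A B = \<lparr> pverts = pverts A \<times> pverts B,
     parcs = {((v, x), (w, y)). (v, x) \<in> pverts A \<times> pverts B \<and> (w, y) \<in> pverts A \<times> pverts B \<and>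
       (v, x) \<noteq> (w, y) \<and>
       ((v = w \<and> (x, y) \<in> parcs B) \<or>
        (x = y \<and> (v, w) \<in> parcs A) \<or>
        ((v, w) \<in> parcs A \<and> (x, y) \<in> parcs B))} \<rparr>"

definition contained_in :: "'a pair_pre_digraph \<Rightarrow> 'b pair_pre_digraph \<Rightarrow> bool" where
  "contained_in G H \<longleftrightarrow> (\<exists>G' :: 'b pair_pre_digraph.
     subgraph (with_proj G') (with_proj H) \<and> digraph_iso (with_proj G) (with_proj G'))"

text \<open>Meaningful only if \<open>h n > 0\<close>: otherwise \<open>1 - \<epsilon> powr h n\<close> is not positive.\<close>

definition delta :: "real \<Rightarrow> (nat \<Rightarrow> real) \<Rightarrow> nat \<Rightarrow> real" where
  "delta \<epsilon> h n = (1 - \<epsilon>) * (inverse (1 - \<epsilon> powr h n) - 1)"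

end

theory Submission
  imports Defs "HOL-Library.Disjoint_Sets" "HOL-Library.Sublist"
begin

text \<open>
  Put \<open>B = c 2\<^sup>\<epsilon> / (2\<^sup>\<epsilon> - 1)\<close>. Separating repeatedly every piece with more than \<open>p\<close> vertices
  removes at most \<open>B n / p\<^sup>\<epsilon>\<close> vertices in total, since the piece sizes at least halve at each
  step and the costs form a geometric series. Let \<open>d = \<lceil>h n\<rceil>\<close>,
  \<open>\<beta> = (1 - \<epsilon>) / (1 - \<epsilon>\<^sup>d)\<close>, and apply this with target sizes
  \<open>n powr (\<beta> (1 + \<epsilon> + \<dots> + \<epsilon>\<^sup>k\<^sup>-\<^sup>1))\<close> for \<open>k = d - 1, \<dots>, 1\<close> in turn, starting from \<open>n\<close>
  vertices, which is the value for \<open>k = d\<close>. Each separator within a piece then has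
  at most \<open>B n\<^sup>\<beta>\<close> vertices, and so has each of the last pieces. Separators and last pieces are
  the nodes of a rooted tree on \<open>d\<close> levels such that edges of the graph only join vertices whose
  nodes are equal or ancestor and descendant.
\<close>


section \<open>Separations of vertex sets and their refinement\<close>

text \<open>The pieces in \<open>\<C>\<close> are pairwise nonadjacent but need not be connected, so
  a set may also be left whole.\<close>

definition separation :: "'a rel \<Rightarrow> 'a set \<Rightarrow> 'a set \<Rightarrow> 'a set set \<Rightarrow> bool" where
  "separation E W S \<C> \<longleftrightarrow> S \<subseteq> W \<and> partition_on (W - S) \<C> \<and>
     (\<forall>C\<in>\<C>. \<forall>D\<in>\<C>. C \<noteq> D \<longrightarrow> E \<inter> C \<times> D = {})"

text \<open>Blocks of a partition are nonempty; removing \<open>{}\<close> covers the case of empty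
  \<open>W\<close>.\<close>

lemma separation_trivial: "separation E W {} ({W} - {{}})"
  by (cases "W = {}") (auto simp: separation_def partition_on_def)

lemma separation_subset: "separation E W S \<C> \<Longrightarrow> C \<in> \<C> \<Longrightarrow> C \<subseteq> W"
  by (auto simp: separation_def partition_on_def)

text \<open>Two refined pieces lie in the same member of \<open>\<C>\<close>, where the inner
  separation keeps them apart, or in different members, where the outer one does.\<close>

lemma separation_refine:
  assumes "separation E W S \<C>" and "\<And>C. C \<in> \<C> \<Longrightarrow> separation E C (T C) (\<D> C)"
  shows "separation E W (S \<union> (\<Union>C\<in>\<C>. T C)) (\<Union>C\<in>\<C>. \<D> C)"
proof -
  have U: "\<Union>\<C> = W - S" and dj: "disjoint \<C>" and SW: "S \<subseteq> W"
    and cross: "\<And>C D. C \<in> \<C> \<Longrightarrow> D \<in> \<C> \<Longrightarrow> C \<noteq> D \<Longrightarrow> E \<inter> C \<times> D = {}"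
    using assms(1) by (auto simp: separation_def partition_on_def)
  have T: "T C \<subseteq> C" and UD: "\<Union>(\<D> C) = C - T C" and djD: "disjoint (\<D> C)"
    and ne: "{} \<notin> \<D> C"
    and crossD: "\<And>X Y. X \<in> \<D> C \<Longrightarrow> Y \<in> \<D> C \<Longrightarrow> X \<noteq> Y \<Longrightarrow> E \<inter> X \<times> Y = {}"
    if "C \<in> \<C>" for C
    using assms(2)[OF that] by (auto simp: separation_def partition_on_def)
  have sub: "X \<subseteq> C" if "X \<in> \<D> C" "C \<in> \<C>" for X C using UD[OF that(2)] that by auto
  have eq: "C = D" if "v \<in> C" "v \<in> D" "C \<in> \<C>" "D \<in> \<C>" for v C D
    using dj that by (auto simp: disjoint_def)
  have "\<Union>(\<Union>C\<in>\<C>. \<D> C) = W - (S \<union> (\<Union>C\<in>\<C>. T C))"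
  proof -
    have "\<Union>(\<Union>C\<in>\<C>. \<D> C) = (\<Union>C\<in>\<C>. \<Union>(\<D> C))" by blast
    also have "\<dots> = (\<Union>C\<in>\<C>. C - T C)" using UD by simp
    also have "\<dots> = \<Union>\<C> - (\<Union>C\<in>\<C>. T C)" using T eq by blast
    finally show ?thesis using U by auto
  qed
  moreover have "disjoint (\<Union>C\<in>\<C>. \<D> C)"
    unfolding disjoint_def
  proof (intro ballI impI)
    fix X Y assume "X \<in> (\<Union>C\<in>\<C>. \<D> C)" "Y \<in> (\<Union>C\<in>\<C>. \<D> C)" "X \<noteq> Y"
    then obtain C D where *: "X \<in> \<D> C" "C \<in> \<C>" "Y \<in> \<D> D" "D \<in> \<C>" by auto
    show "X \<inter> Y = {}"
    proof (cases "C = D")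
      case True
      with * djD[of C] \<open>X \<noteq> Y\<close> show ?thesis by (auto simp: disjoint_def)
    next
      case False
      with * eq sub show ?thesis by blast
    qed
  qed
  moreover have "E \<inter> X \<times> Y = {}" if XY: "X \<in> (\<Union>C\<in>\<C>. \<D> C)" "Y \<in> (\<Union>C\<in>\<C>. \<D> C)" "X \<noteq> Y" for X Y
  proof -
    obtain C D where *: "X \<in> \<D> C" "C \<in> \<C>" "Y \<in> \<D> D" "D \<in> \<C>" using XY by auto
    show ?thesis
    proof (cases "C = D")
      case True
      with * crossD[of C] XY show ?thesis by auto
    next
      case False
      have "X \<subseteq> C" "Y \<subseteq> D" using sub * by auto
      with cross[of C D] * False show ?thesis by blast
    qed
  qed
  moreover have "S \<union> (\<Union>C\<in>\<C>. T C) \<subseteq> W" using SW T U by blast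
  ultimately show ?thesis using ne by (auto simp: separation_def partition_on_def)
qed

lemma card_separation:
  assumes "separation E W S \<C>" "finite W"
  shows "(\<Sum>C\<in>\<C>. card C) \<le> card W"
proof -
  have "partition_on (W - S) \<C>" using assms(1) by (simp add: separation_def)
  then have "card (W - S) = (\<Sum>C\<in>\<C>. card C)"
    using assms(2) by (intro product_partition) (auto simp: partition_on_def intro: finite_subset)
  then show ?thesis using assms(2) by (metis card_mono Diff_subset)
qed

section \<open>Labellings by the nodes of a rooted tree\<close>

text \<open>A label names a node of a rooted tree by the list of nodes from it up to the root, so that
  the ancestors of a node are the nonempty suffixes of its name.\<close>

definition tree_labelling ::
    "'a rel \<Rightarrow> 'a set \<Rightarrow> nat \<Rightarrow> real \<Rightarrow> ('a \<Rightarrow> 'b list) \<Rightarrow> bool" where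
  "tree_labelling E W k M label \<longleftrightarrow>
     (\<forall>v\<in>W. label v \<noteq> [] \<and> length (label v) \<le> k) \<and>
     (\<forall>u\<in>W. \<forall>v\<in>W. (u, v) \<in> E \<longrightarrow> suffix (label u) (label v) \<or> suffix (label v) (label u)) \<and>
     (\<forall>l. real (card {v \<in> W. label v = l}) \<le> M)"

text \<open>\<open>S\<close> becomes the root, and the trees of the pieces are hung below it by
  appending \<open>W\<close> to their labels. The root of each of these trees is named after its
  piece, so labels from different pieces never coincide.\<close>

lemma tree_labelling_step:
  assumes sep: "separation E W S \<C>" and "finite W" and SM: "real (card S) \<le> M"
    and IH: "\<And>C. C \<in> \<C> \<Longrightarrow> tree_labelling E C k M (\<psi> C) \<and> (\<forall>v\<in>C. last (\<psi> C v) = C)"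
  shows "\<exists>label. tree_labelling E W (Suc k) M label \<and> (\<forall>v\<in>W. last (label v) = W)"
proof -
  have U: "\<Union>\<C> = W - S" and dj: "disjoint \<C>" and SW: "S \<subseteq> W"
    and cross: "\<And>C D. C \<in> \<C> \<Longrightarrow> D \<in> \<C> \<Longrightarrow> C \<noteq> D \<Longrightarrow> E \<inter> C \<times> D = {}"
    using sep by (auto simp: separation_def partition_on_def)
  have IHl: "\<psi> C v \<noteq> []" "length (\<psi> C v) \<le> k" "last (\<psi> C v) = C" if "v \<in> C" "C \<in> \<C>" for v C
    using IH[OF that(2)] that(1) by (auto simp: tree_labelling_def)
  define part where "part v = (THE C. C \<in> \<C> \<and> v \<in> C)" for v
  have part: "part v = C" if "v \<in> C" "C \<in> \<C>" for v C
    unfolding part_def using that dj by (intro the_equality) (auto simp: disjoint_def)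
  define label where "label v = (if v \<in> S then [W] else \<psi> (part v) v @ [W])" for v
  have S: "label v = [W]" if "v \<in> S" for v using that by (simp add: label_def)
  have C: "label v = \<psi> C v @ [W]" if "v \<in> C" "C \<in> \<C>" for v C
    using that U part by (auto simp: label_def)
  have cases: "v \<in> S \<or> (\<exists>C\<in>\<C>. v \<in> C)" if "v \<in> W" for v using that U by blast
  have "last (label v) = W" for v
    by (simp add: label_def)
  moreover have "label v \<noteq> [] \<and> length (label v) \<le> Suc k" if "v \<in> W" for v
    using cases[OF that] C S IHl by fastforce
  moreover have "suffix (label u) (label v) \<or> suffix (label v) (label u)"
    if uv: "u \<in> W" "v \<in> W" "(u, v) \<in> E" for u v
  proof (cases "u \<in> S \<or> v \<in> S")
    case True
    \<comment> \<open>\<open>[W]\<close> is a suffix of every label.\<close>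
    then show ?thesis by (auto simp: label_def)
  next
    case False
    then obtain C where "C \<in> \<C>" "u \<in> C" using cases[of u] uv by auto
    moreover obtain D where "D \<in> \<C>" "v \<in> D" using False cases[of v] uv by auto
    ultimately have *: "C \<in> \<C>" "u \<in> C" "D \<in> \<C>" "v \<in> D" by auto
    with cross uv have "C = D" by blast
    with * IH[of C] uv have "suffix (\<psi> C u) (\<psi> C v) \<or> suffix (\<psi> C v) (\<psi> C u)"
      by (auto simp: tree_labelling_def)
    with * \<open>C = D\<close> show ?thesis by (simp add: C)
  qed
  moreover have "real (card {v \<in> W. label v = l}) \<le> M" for l
  proof (cases "\<exists>C\<in>\<C>. \<exists>v\<in>C. label v = l")
    case True
    then obtain C v where *: "C \<in> \<C>" "v \<in> C" "label v = l" by auto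
    \<comment> \<open>All vertices labelled \<open>l\<close> lie in one piece:
      \<open>\<psi> C v\<close> is nonempty, which excludes \<open>S\<close>, and its last entry is
      \<open>C\<close>.\<close>
    have "{u \<in> W. label u = l} \<subseteq> {u \<in> C. \<psi> C u = \<psi> C v}"
    proof
      fix u assume u: "u \<in> {u \<in> W. label u = l}"
      have l: "l = \<psi> C v @ [W]" using C * by auto
      have "u \<notin> S" using u l IHl(1)[of v C] * S[of u] by auto
      then obtain D where D: "D \<in> \<C>" "u \<in> D" using u cases by auto
      then have "\<psi> D u = \<psi> C v" using u l C by auto
      then have "D = C" using IHl(3) D * by metis
      then show "u \<in> {u \<in> C. \<psi> C u = \<psi> C v}" using D \<open>\<psi> D u = \<psi> C v\<close> by simp
    qed
    moreover have "finite C" using separation_subset[OF sep *(1)] \<open>finite W\<close> finite_subset by auto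
    ultimately have "card {u \<in> W. label u = l} \<le> card {u \<in> C. \<psi> C u = \<psi> C v}"
      by (intro card_mono) auto
    moreover have "real (card {u \<in> C. \<psi> C u = \<psi> C v}) \<le> M"
      using IH[OF *(1)] by (auto simp: tree_labelling_def)
    ultimately show ?thesis by linarith
  next
    case False
    then have "{v \<in> W. label v = l} \<subseteq> S" using cases by blast
    then have "card {v \<in> W. label v = l} \<le> card S"
      using SW \<open>finite W\<close> by (intro card_mono) (auto intro: finite_subset)
    then show ?thesis using SM by linarith
  qed
  ultimately show ?thesis unfolding tree_labelling_def by blast
qed

section \<open>Shattering a set into small pieces\<close>

text \<open>Heredity becomes a condition on every subset \<open>W\<close> of one vertex set. The
  bound \<open>c1\<close> is conditional because a null graph does not constrain
  \<open>c\<close>.\<close>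

locale separable =
  fixes E :: "'a rel" and V :: "'a set" and \<epsilon> c :: real
  assumes finite_V: "finite V" and eps: "0 < \<epsilon>" "\<epsilon> < 1"
    and c1: "V \<noteq> {} \<Longrightarrow> 1 \<le> c"
    and separable: "W \<subseteq> V \<Longrightarrow> \<exists>S \<C>. separation E W S \<C> \<and>
      real (card S) \<le> c * real (card W) powr (1 - \<epsilon>) \<and> (\<forall>C\<in>\<C>. real (card C) \<le> real (card W) / 2)"
begin

text \<open>The sum of the geometric series with first term \<open>c\<close> and ratio
  \<open>2 powr - \<epsilon>\<close>.\<close>

abbreviation B :: real where "B \<equiv> c * 2 powr \<epsilon> / (2 powr \<epsilon> - 1)"

lemma two_powr: "1 < 2 powr \<epsilon>" using eps by simp

text \<open>Lets last pieces of at most \<open>n powr \<beta>\<close> vertices obey the bound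
  \<open>B * n powr \<beta>\<close> on separators.\<close>

lemma one_le_B: assumes "V \<noteq> {}" shows "1 \<le> B"
proof -
  have "2 powr \<epsilon> - 1 \<le> c * 2 powr \<epsilon>" 
    using c1[OF assms] two_powr mult_right_mono[of 1 c "2 powr \<epsilon>"] by linarith
  then show ?thesis using two_powr by (simp add: field_simps)
qed

text \<open>The bound on \<open>S\<close> has to be strictly stronger than \<open>B * card W * p powr - \<epsilon>\<close> for the
  induction to go through: the gap pays for the first separator. For \<open>card W \<le> p\<close>
  the second argument of \<open>max\<close> may be negative.\<close>

lemma shatter_aux:
  assumes "W \<subseteq> V" "0 < p" "V \<noteq> {}"
  shows "\<exists>S \<C>. separation E W S \<C> \<and> (\<forall>C\<in>\<C>. real (card C) \<le> p) \<and>
    real (card S) \<le> real (card W) *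
      max 0 (c / (2 powr \<epsilon> - 1) * (2 powr \<epsilon> * p powr - \<epsilon> - real (card W) powr - \<epsilon>))"
  using assms(1)
proof (induction "card W" arbitrary: W rule: less_induct)
  case less
  have fin: "finite W" using less.prems finite_V finite_subset by auto
  define A where "A = c / (2 powr \<epsilon> - 1)"
  define w where "w = real (card W)"
  have A: "0 \<le> A" using c1[OF assms(3)] two_powr by (simp add: A_def)
  show ?case
  proof (cases "w \<le> p")
    case True
    then show ?thesis
      by (intro exI[of _ "{}"] exI[of _ "{W} - {{}}"]) (auto simp: separation_trivial w_def)
  next
    case False
    then have w: "0 < w" "p < w" using assms(2) by auto
    obtain S \<C> where sep: "separation E W S \<C>" and S: "real (card S) \<le> c * w powr (1 - \<epsilon>)"
      and half: "\<And>C. C \<in> \<C> \<Longrightarrow> real (card C) \<le> w / 2"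
      using separable[OF less.prems] unfolding w_def by auto
    have CW: "C \<subseteq> W" if "C \<in> \<C>" for C using separation_subset[OF sep that] .
    have ne: "{} \<notin> \<C>" using sep by (simp add: separation_def partition_on_def)
    have finC: "finite \<C>" using CW fin by (meson finite_Pow_iff finite_subset PowI subsetI)
    \<comment> \<open>The cost per vertex that the induction hypothesis allows at size
      \<open>w / 2\<close>, the largest possible size of a piece.\<close>
    define G where "G = A * (2 powr \<epsilon> * p powr - \<epsilon> - (w / 2) powr - \<epsilon>)"
    have half_powr: "(w / 2) powr - \<epsilon> = 2 powr \<epsilon> * w powr - \<epsilon>"
      using w by (simp add: powr_divide powr_minus field_simps)
    have "w powr - \<epsilon> \<le> p powr - \<epsilon>" using w assms(2) eps by (intro powr_mono2') auto
    \<comment> \<open>As \<open>G\<close> is nonnegative, it also dominates the value 0 of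
      \<open>max\<close> for small pieces.\<close>
    then have G0: "0 \<le> G" unfolding G_def half_powr using A by (intro mult_nonneg_nonneg) auto
    have "\<exists>T \<D>. separation E C T \<D> \<and> (\<forall>D\<in>\<D>. real (card D) \<le> p) \<and>
        real (card T) \<le> real (card C) * G" if C: "C \<in> \<C>" for C
    proof -
      \<comment> \<open>Positivity matters below: \<open>0 powr - \<epsilon>\<close> is 0, so the
        negative power is antitone only on positive sizes.\<close>
      have "finite C" "C \<noteq> {}" using C CW fin finite_subset ne by (blast, auto)
      then have C0: "0 < real (card C)" by (simp add: card_gt_0_iff)
      have "real (card C) < w" using half[OF C] w by simp
      then obtain T \<D> where T: "separation E C T \<D>" "\<forall>D\<in>\<D>. real (card D) \<le> p"
        "real (card T) \<le> real (card C) * max 0 (A * (2 powr \<epsilon> * p powr - \<epsilon> - real (card C) powr - \<epsilon>))"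
        using less.hyps[of C] CW[OF C] less.prems unfolding w_def A_def by auto
      have "(w / 2) powr - \<epsilon> \<le> real (card C) powr - \<epsilon>"
        using half[OF C] C0 eps by (intro powr_mono2') auto
      then have "max 0 (A * (2 powr \<epsilon> * p powr - \<epsilon> - real (card C) powr - \<epsilon>)) \<le> G"
        using G0 A unfolding G_def by (auto intro!: mult_left_mono)
      then have "real (card T) \<le> real (card C) * G"
        using T(3) C0 by (meson less_imp_le mult_left_mono order_trans)
      with T show ?thesis by blast
    qed
    then obtain T \<D> where T: "\<And>C. C \<in> \<C> \<Longrightarrow> separation E C (T C) (\<D> C)"
      and D: "\<And>C. C \<in> \<C> \<Longrightarrow> \<forall>D\<in>\<D> C. real (card D) \<le> p"
      and cT: "\<And>C. C \<in> \<C> \<Longrightarrow> real (card (T C)) \<le> real (card C) * G"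
      by metis
    let ?S = "S \<union> (\<Union>C\<in>\<C>. T C)"
    have "card ?S \<le> card S + (\<Sum>C\<in>\<C>. card (T C))"
      using card_Un_le[of S "\<Union>C\<in>\<C>. T C"] card_UN_le[OF finC, of T] by linarith
    then have "real (card ?S) \<le> real (card S) + (\<Sum>C\<in>\<C>. real (card (T C)))"
      by (metis of_nat_add of_nat_le_iff of_nat_sum)
    also have "(\<Sum>C\<in>\<C>. real (card (T C))) \<le> (\<Sum>C\<in>\<C>. real (card C)) * G"
      unfolding sum_distrib_right by (intro sum_mono cT)
    also have "(\<Sum>C\<in>\<C>. real (card C)) \<le> w"
      using card_separation[OF sep fin] unfolding w_def by (metis of_nat_le_iff of_nat_sum)
    also have "real (card S) + w * G \<le> c * w powr (1 - \<epsilon>) + w * G" using S by simp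
    \<comment> \<open>Passing from \<open>(w / 2) powr - \<epsilon>\<close> to
      \<open>w powr - \<epsilon>\<close> frees exactly
      \<open>w * A * (2 powr \<epsilon> - 1) * w powr - \<epsilon>\<close>, which is the cost of
      \<open>S\<close>.\<close>
    also have "\<dots> = w * (A * (2 powr \<epsilon> * p powr - \<epsilon> - w powr - \<epsilon>))"
    proof -
      have w_powr: "w powr (1 - \<epsilon>) = w * w powr - \<epsilon>" using w powr_add[of w 1 "- \<epsilon>"] by simp
      have c: "A * (2 powr \<epsilon> - 1) = c" using two_powr eps by (simp add: A_def)
      have "c * w powr (1 - \<epsilon>) = A * (2 powr \<epsilon> - 1) * (w * w powr - \<epsilon>)" by (simp only: w_powr c)
      then show ?thesis unfolding G_def half_powr by (simp add: algebra_simps)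
    qed
    also have "\<dots> \<le> w * max 0 (A * (2 powr \<epsilon> * p powr - \<epsilon> - w powr - \<epsilon>))"
      using w by (intro mult_left_mono) auto
    finally have "real (card ?S) \<le> w * max 0 (A * (2 powr \<epsilon> * p powr - \<epsilon> - w powr - \<epsilon>))"
      using G0 by (simp add: mult_right_mono)
    moreover have "separation E W ?S (\<Union>C\<in>\<C>. \<D> C)" by (rule separation_refine[OF sep T])
    ultimately show ?thesis using D unfolding w_def A_def by blast
  qed
qed

text \<open>Dropping the subtracted power of \<open>card W\<close> leaves the factor
  \<open>c / (2 powr \<epsilon> - 1) * 2 powr \<epsilon>\<close>, which is \<open>B\<close>.\<close>

lemma shatter:
  assumes "W \<subseteq> V" "0 < p" "V \<noteq> {}"
  shows "\<exists>S \<C>. separation E W S \<C> \<and> (\<forall>C\<in>\<C>. real (card C) \<le> p) \<and>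
    real (card S) \<le> B * (real (card W) * p powr - \<epsilon>)"
proof -
  let ?A = "c / (2 powr \<epsilon> - 1)"
  have A: "0 \<le> ?A" using c1[OF assms(3)] two_powr by simp
  have "max 0 (?A * (2 powr \<epsilon> * p powr - \<epsilon> - real (card W) powr - \<epsilon>)) \<le> ?A * (2 powr \<epsilon> * p powr - \<epsilon>)"
  proof (rule max.boundedI)
    show "0 \<le> ?A * (2 powr \<epsilon> * p powr - \<epsilon>)" using A by (intro mult_nonneg_nonneg) auto
    show "?A * (2 powr \<epsilon> * p powr - \<epsilon> - real (card W) powr - \<epsilon>) \<le> ?A * (2 powr \<epsilon> * p powr - \<epsilon>)"
      using A by (intro mult_left_mono) auto
  qed
  then have "real (card W) * max 0 (?A * (2 powr \<epsilon> * p powr - \<epsilon> - real (card W) powr - \<epsilon>))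
      \<le> real (card W) * (?A * (2 powr \<epsilon> * p powr - \<epsilon>))"
    by (rule mult_left_mono) simp
  also have "\<dots> = B * (real (card W) * p powr - \<epsilon>)" by simp
  finally show ?thesis using shatter_aux[OF assms] by (meson order_trans)
qed

section \<open>Shattering level by level\<close>

text \<open>The geometric sums satisfy \<open>s' = 1 + \<epsilon> * s\<close>, so shattering
  \<open>n powr (\<beta> * s')\<close> vertices to size \<open>n powr (\<beta> * s)\<close> costs
  \<open>B\<close> times \<open>n\<close> to the power
  \<open>\<beta> * (s' - \<epsilon> * s) = \<beta>\<close>, the same on every level.\<close>

lemma tree_labelling_levels:
  assumes "V \<noteq> {}" and n: "0 < n"
  shows "W \<subseteq> V \<Longrightarrow> real (card W) \<le> n powr (\<beta> * (\<Sum>i<Suc k. \<epsilon> ^ i)) \<Longrightarrow>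
    \<exists>label :: 'a \<Rightarrow> 'a set list. tree_labelling E W (Suc k) (B * n powr \<beta>) label \<and>
      (\<forall>v\<in>W. last (label v) = W)"
proof (induction k arbitrary: W)
  case 0
  have "finite W" using 0 finite_V finite_subset by auto
  have "real (card W) \<le> n powr \<beta>" using 0 by simp
  also have "\<dots> \<le> B * n powr \<beta>" using one_le_B[OF assms(1)] mult_right_mono[of 1 B "n powr \<beta>"] by simp
  finally have "real (card {v \<in> W. P v}) \<le> B * n powr \<beta>" for P
    using card_mono[OF \<open>finite W\<close>, of "{v \<in> W. P v}"] by (simp add: order_trans[rotated])
  then show ?case by (intro exI[of _ "\<lambda>_. [W]"]) (auto simp: tree_labelling_def)
next
  case (Suc k)
  define s where "s = (\<Sum>i<Suc k. \<epsilon> ^ i)"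
  have fin: "finite W" using Suc.prems finite_V finite_subset by auto
  have s': "(\<Sum>i<Suc (Suc k). \<epsilon> ^ i) = 1 + \<epsilon> * s"
    unfolding s_def by (subst sum.lessThan_Suc_shift) (simp add: sum_distrib_left distrib_left)
  let ?p = "n powr (\<beta> * s)"
  obtain S \<C> where sep: "separation E W S \<C>" and C: "\<And>C. C \<in> \<C> \<Longrightarrow> real (card C) \<le> ?p"
    and S: "real (card S) \<le> B * (real (card W) * ?p powr - \<epsilon>)"
    using shatter[OF Suc.prems(1) _ assms(1), of ?p] n by auto
  have "real (card W) * ?p powr - \<epsilon> \<le> n powr (\<beta> * (1 + \<epsilon> * s)) * ?p powr - \<epsilon>"
    using Suc.prems(2) unfolding s' by (intro mult_right_mono) auto
  also have "\<dots> = n powr \<beta>"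
    by (simp add: powr_powr powr_add[symmetric] algebra_simps)
  finally have "real (card S) \<le> B * n powr \<beta>"
    using S one_le_B[OF assms(1)] mult_left_mono[of "real (card W) * ?p powr - \<epsilon>" "n powr \<beta>" B]
    by linarith
  moreover have "\<exists>label :: 'a \<Rightarrow> 'a set list. tree_labelling E C (Suc k) (B * n powr \<beta>) label \<and>
      (\<forall>v\<in>C. last (label v) = C)" if "C \<in> \<C>" for C
    using Suc.IH[of C] C[OF that] separation_subset[OF sep that] Suc.prems(1) unfolding s_def by auto
  then obtain \<psi> :: "'a set \<Rightarrow> 'a \<Rightarrow> 'a set list" where
    "\<And>C. C \<in> \<C> \<Longrightarrow> tree_labelling E C (Suc k) (B * n powr \<beta>) (\<psi> C) \<and> (\<forall>v\<in>C. last (\<psi> C v) = C)"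
    by metis
  ultimately show ?case by (intro tree_labelling_step[OF sep fin])
qed

text \<open>The exponent \<open>\<beta>\<close> is normalised so that its product with the full
  geometric sum is 1; then \<open>V\<close> itself meets the size bound of the top level.\<close>

lemma ex_tree_labelling:
  assumes "0 < d"
  shows "\<exists>label :: 'a \<Rightarrow> 'a set list.
    tree_labelling E V d (B * real (card V) powr ((1 - \<epsilon>) / (1 - \<epsilon> ^ d))) label"
proof (cases "V = {}")
  case True
  \<comment> \<open>All fibres are empty, and \<open>0 powr x\<close> is 0.\<close>
  then show ?thesis by (simp add: tree_labelling_def)
next
  case False
  obtain k where k: "d = Suc k" using assms gr0_implies_Suc by auto
  define \<beta> where "\<beta> = (1 - \<epsilon>) / (1 - \<epsilon> ^ d)"
  have "\<epsilon> ^ d < 1" using eps assms by (simp add: power_less_one_iff)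
  then have "\<beta> * (\<Sum>i<Suc k. \<epsilon> ^ i) = 1"
    using eps unfolding \<beta>_def k[symmetric] by (simp add: sum_gp_strict)
  moreover have "0 < card V" using False finite_V by (simp add: card_gt_0_iff)
  ultimately show ?thesis
    using tree_labelling_levels[OF False, of "real (card V)" V \<beta> k]
    unfolding \<beta>_def[symmetric] k[symmetric] by auto
qed

end

section \<open>From hereditary graph classes to separable vertex sets\<close>

lemma pair_graph_induced:
  assumes "pair_graph G" "W \<subseteq> pverts G"
  defines "GW \<equiv> \<lparr> pverts = W, parcs = parcs G \<inter> W \<times> W \<rparr>"
  shows "induced_subgraph (with_proj GW) (with_proj G)" and "pair_graph GW"
proof -
  interpret G: pair_graph G by fact
  have "finite W" using assms(2) G.pair_finite_verts by (rule finite_subset)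
  then show *: "pair_graph GW"
    using G.no_loops' G.arcs_symmetric unfolding GW_def
    by unfold_locales (auto simp: symmetric_def intro!: symI)
  have "wf_digraph (with_proj GW)" 
    using * by (simp add: wf_digraph_wp_iff pair_graph_def pair_digraph_def pair_fin_digraph_def)
  then show "induced_subgraph (with_proj GW) (with_proj G)"
    using assms(2) G.wf_digraph_axioms
    by (intro induced_subgraphI subgraphI) (auto simp: GW_def)
qed

text \<open>The pieces are the components of \<open>G - S\<close>. By symmetry an arc between two of
  them could be walked both ways and would merge them.\<close>

lemma separation_of_balanced_separator:
  assumes "pair_graph G" "balanced_separator G S"
  shows "\<exists>\<C>. separation (parcs G) (pverts G) S \<C> \<and>
    (\<forall>C\<in>\<C>. real (card C) \<le> real (card (pverts G)) / 2)"
proof -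
  interpret G: pair_graph G by fact
  define H where "H = induce_subgraph (with_proj G) (pverts G - S)"
  have S: "S \<subseteq> pverts G" 
    and small: "\<And>C. C \<in> pre_digraph.sccs H \<Longrightarrow> real (card (verts C)) \<le> real (card (pverts G)) / 2"
    using assms(2) by (auto simp: balanced_separator_def H_def)
  interpret H: wf_digraph H unfolding H_def by (rule G.wellformed_induce_subgraph)
  have vH: "verts H = pverts G - S" by (simp add: H_def)
  have adj: "u \<rightarrow>\<^bsub>H\<^esub> v" if "(u, v) \<in> parcs G" "u \<notin> S" "v \<notin> S" for u v
  proof -
    have "(u, v) \<in> arcs H" using that G.wellformed' by (auto simp: H_def)
    then show ?thesis by (auto simp: arcs_ends_def arc_to_ends_def H_def image_iff intro!: bexI)
  qed
  have "\<Union>H.sccs_verts = pverts G - S"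
    using H.sccs_verts_subsets H.scc_of_in_sccs_verts H.in_scc_of_self unfolding vH[symmetric] by blast
  moreover have "disjoint H.sccs_verts"
    unfolding disjoint_def using H.sccs_verts_disjoint by blast
  moreover have "{} \<notin> H.sccs_verts" by (simp add: H.sccs_verts_def)
  moreover have "parcs G \<inter> C \<times> D = {}"
    if CD: "C \<in> H.sccs_verts" "D \<in> H.sccs_verts" "C \<noteq> D" for C D
  proof (rule ccontr)
    assume "parcs G \<inter> C \<times> D \<noteq> {}"
    then obtain u v where uv: "(u, v) \<in> parcs G" "u \<in> C" "v \<in> D" by auto
    then have "u \<notin> S" "v \<notin> S" using CD H.sccs_verts_subsets vH by blast+
    then have "u \<rightarrow>\<^sup>*\<^bsub>H\<^esub> v" "v \<rightarrow>\<^sup>*\<^bsub>H\<^esub> u"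
      using uv adj G.arcs_symmetric by (auto intro!: H.reachable_adjI)
    then have "v \<in> C" using CD(1) uv(2) unfolding H.sccs_verts_def by blast
    then show False using H.sccs_verts_disjoint[OF CD] uv(3) by blast
  qed
  ultimately have "separation (parcs G) (pverts G) S H.sccs_verts"
    using S by (simp add: separation_def partition_on_def)
  then show ?thesis using small by (auto simp: H.sccs_verts_conv)
qed

text \<open>The minimum is attained because some balanced separator exists: removing all vertices
  leaves no component.\<close>

lemma ex_balanced_separator_sep: "\<exists>S. balanced_separator G S \<and> card S = sep G"
proof -
  have "balanced_separator G (pverts G)"
    by (auto simp: balanced_separator_def pre_digraph.sccs_def induced_subgraph_def subgraph_def
        strongly_connected_def)
  then have "\<exists>k. \<exists>S. balanced_separator G S \<and> card S = k" by blast
  then show ?thesis unfolding sep_def by (rule LeastI_ex)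
qed

lemma hereditary_pair_graph: "hereditary \<G> \<Longrightarrow> G \<in> \<G> \<Longrightarrow> pair_graph G"
  unfolding hereditary_def by blast

lemma hereditary_induced:
  "hereditary \<G> \<Longrightarrow> G \<in> \<G> \<Longrightarrow> induced_subgraph (with_proj G') (with_proj G) \<Longrightarrow> G' \<in> \<G>"
  unfolding hereditary_def by blast

lemma separable_hereditary:
  assumes "hereditary \<G>" "G \<in> \<G>" "0 < \<epsilon>" "\<epsilon> < 1"
    and sep: "\<forall>G\<in>\<G>. real (sep G) \<le> c * real (card (pverts G)) powr (1 - \<epsilon>)"
  shows "separable (parcs G) (pverts G) \<epsilon> c"
proof -
  have G: "pair_graph G" by (rule hereditary_pair_graph[OF assms(1,2)])
  interpret G: pair_graph G by fact
  have *: "\<exists>S \<C>. separation (parcs G) W S \<C> \<and> real (card S) \<le> c * real (card W) powr (1 - \<epsilon>) \<and>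
    (\<forall>C\<in>\<C>. real (card C) \<le> real (card W) / 2)" if W: "W \<subseteq> pverts G" for W
  proof -
    define GW where "GW = \<lparr> pverts = W, parcs = parcs G \<inter> W \<times> W \<rparr>"
    have "pair_graph GW" "GW \<in> \<G>"
      using pair_graph_induced[OF G W] hereditary_induced[OF assms(1,2)] unfolding GW_def by blast+
    obtain S where S: "balanced_separator GW S" "card S = sep GW"
      using ex_balanced_separator_sep by blast
    obtain \<C> where \<C>: "separation (parcs GW) (pverts GW) S \<C>"
      "\<forall>C\<in>\<C>. real (card C) \<le> real (card (pverts GW)) / 2"
      using separation_of_balanced_separator[OF \<open>pair_graph GW\<close> S(1)] by blast
    \<comment> \<open>Pieces lie inside \<open>W\<close>, so an arc of \<open>G\<close> between two
      of them is an arc of \<open>GW\<close>.\<close>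
    have "separation (parcs G) W S \<C>"
      using \<C>(1) separation_subset[OF \<C>(1)] unfolding separation_def GW_def by fastforce
    moreover have "real (card S) \<le> c * real (card W) powr (1 - \<epsilon>)"
      using sep \<open>GW \<in> \<G>\<close> S(2) by (auto simp: GW_def)
    ultimately show ?thesis using \<C>(2) by (auto simp: GW_def)
  qed
  \<comment> \<open>A one-vertex piece exceeds half of a single vertex, so a balanced separator of
    \<open>{v}\<close> is \<open>{v}\<close> itself and has size 1.\<close>
  have "1 \<le> c" if ne: "pverts G \<noteq> {}"
  proof -
    obtain v where v: "{v} \<subseteq> pverts G" using ne by auto
    obtain S \<C> where S: "separation (parcs G) {v} S \<C>" "real (card S) \<le> c"
      "\<forall>C\<in>\<C>. real (card C) \<le> 1 / 2"
      using *[OF v] by auto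
    have "S = {v}"
    proof (rule ccontr)
      assume "S \<noteq> {v}"
      then have "S = {}" using S(1) by (auto simp: separation_def)
      then have "\<Union>\<C> = {v}" using S(1) by (auto simp: separation_def partition_on_def)
      then obtain C where C: "C \<in> \<C>" "v \<in> C" by blast
      then have "C = {v}" using separation_subset[OF S(1)] by blast
      with S(3) C show False by auto
    qed
    with S(2) show ?thesis by simp
  qed
  then show ?thesis using * assms(3,4) G.pair_finite_verts by unfold_locales auto
qed

section \<open>Ranked forests and tree-depth\<close>

text \<open>A rank that rises along arcs excludes directed cycles, and its range from 1 to
  \<open>d\<close> bounds the number of vertices on a path by \<open>d\<close>.\<close>

locale ranked_forest =
  fixes F :: "'a pair_pre_digraph" and rank :: "'a \<Rightarrow> nat" and d :: nat
  assumes finite_verts: "finite (pverts F)"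
    and arcs_verts: "parcs F \<subseteq> pverts F \<times> pverts F"
    and rank_less: "(u, v) \<in> parcs F \<Longrightarrow> rank u < rank v"
    and rank_le: "v \<in> pverts F \<Longrightarrow> 1 \<le> rank v \<and> rank v \<le> d"
    and unique_parent: "(u, w) \<in> parcs F \<Longrightarrow> (v, w) \<in> parcs F \<Longrightarrow> u = v"
begin

lemma rank_less_trancl: "(u, v) \<in> (parcs F)\<^sup>+ \<Longrightarrow> rank u < rank v"
  by (induction rule: trancl_induct) (auto dest: rank_less)

lemma finite_arcs: "finite (parcs F)"
  using arcs_verts finite_verts by (meson finite_SigmaI finite_subset)

lemma pair_digraph: "pair_digraph F"
  using arcs_verts finite_verts finite_arcs rank_less by unfold_locales fastforce+

lemma rooted_forest: "rooted_forest F"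
proof -
  interpret pair_digraph F by (rule pair_digraph)
  have "forest (with_proj F)"
    unfolding forest_def
  proof
    assume "\<exists>p. pre_digraph.cycle (with_proj F) p"
    then obtain u p where "awalk u p u" "p \<noteq> []" by (auto simp: cycle_def)
    then have "(u, u) \<in> (parcs F)\<^sup>+" using reachable1_awalkI by auto
    then show False using rank_less_trancl by blast
  qed
  moreover have "in_degree (with_proj F) v \<le> 1" for v
  proof -
    have "card (in_arcs (with_proj F) v) \<le> Suc 0"
      using unique_parent by (intro card_le_Suc0_iff_eq[THEN iffD2]) (auto simp: in_arcs_def finite_arcs)
    then show ?thesis by (simp add: in_degree_def)
  qed
  ultimately show ?thesis using pair_digraph by (simp add: rooted_forest_def)
qed

text \<open>The rank rises by at least one per arc, and a walk has one vertex more than arcs, hence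
  the \<open>Suc\<close>.\<close>

lemma length_vwalk: "vwalk p (with_proj F) \<Longrightarrow> length p + rank (hd p) \<le> Suc (rank (last p))"
proof (induction p rule: vwalk_induct)
  case (Cons u v es)
  then have "rank u < rank v" using rank_less by simp
  with Cons show ?case by simp
qed simp

lemma forest_height_le: "forest_height F \<le> d"
proof -
  have "length p \<le> d" if "root_leaf_path F p" for p
  proof -
    have p: "vwalk p (with_proj F)" using that by (auto simp: root_leaf_path_def vpath_def)
    then have "hd p \<in> pverts F" "last p \<in> pverts F" by (auto simp: vwalk_def)
    then show ?thesis using length_vwalk[OF p] rank_le[of "hd p"] rank_le[of "last p"] by linarith
  qed
  \<comment> \<open>The bound also provides the finiteness that \<open>Max\<close> requires.\<close>
  then have "length ` {p. root_leaf_path F p} \<subseteq> {..d}" by auto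
  then show ?thesis
    unfolding forest_height_def using finite_subset by (intro Max.boundedI) auto
qed

lemma trancl_verts: "(u, v) \<in> (parcs F)\<^sup>+ \<Longrightarrow> u \<in> pverts F \<and> v \<in> pverts F"
  using trancl_subset_Sigma[OF arcs_verts] by auto

lemma pair_graph_closure: "pair_graph (forest_closure F)"
proof -
  have "parcs (forest_closure F) \<subseteq> pverts F \<times> pverts F"
    by (auto simp: forest_closure_def dest: trancl_verts)
  then have "finite (parcs (forest_closure F))"
    using finite_verts by (meson finite_SigmaI finite_subset)
  then show ?thesis
    using finite_verts by unfold_locales
      (auto simp: forest_closure_def symmetric_def dest: trancl_verts rank_less_trancl intro!: symI)
qed

lemma tree_depth_closure: "tree_depth (forest_closure F) \<le> d"
proof -
  interpret pair_graph "forest_closure F" by (rule pair_graph_closure)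
  have "tree_depth (forest_closure F) \<le> forest_height F"
    unfolding tree_depth_def using rooted_forest subgraph_refl by (intro Least_le) blast
  then show ?thesis using forest_height_le by simp
qed

end

text \<open>Nodes are the nonempty suffixes of labels, coded injectively by natural numbers; the
  parent of a suffix is its tail and its rank is its length.\<close>

lemma ex_nat_forest_of_labelling:
  fixes label :: "'a \<Rightarrow> 'b list"
  assumes "finite V" and label: "\<And>v. v \<in> V \<Longrightarrow> label v \<noteq> [] \<and> length (label v) \<le> d"
  shows "\<exists>(F :: nat pair_pre_digraph) rank node. ranked_forest F rank d \<and>
    inj_on node (label ` V) \<and> node ` label ` V \<subseteq> pverts F \<and>
    (\<forall>u\<in>V. \<forall>v\<in>V. strict_suffix (label u) (label v) \<longrightarrow> (node (label u), node (label v)) \<in> (parcs F)\<^sup>+)"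
proof -
  define N where "N = {s. s \<noteq> [] \<and> (\<exists>v\<in>V. suffix s (label v))}"
  have "N \<subseteq> (\<Union>v\<in>V. set (suffixes (label v)))" by (auto simp: N_def)
  then have "finite N" using \<open>finite V\<close> finite_subset by blast
  then obtain node :: "'b list \<Rightarrow> nat" where inj: "inj_on node N" by (meson finite_imp_inj_to_nat_seg)
  define F where "F = \<lparr> pverts = node ` N,
    parcs = {(node (tl s), node s) | s. s \<in> N \<and> tl s \<noteq> []} \<rparr>"
  define rank where "rank = (\<lambda>x. length (inv_into N node x))"
  have tlN: "tl s \<in> N" if "s \<in> N" "tl s \<noteq> []" for s
    using that suffix_order.trans[OF suffix_tl] by (auto simp: N_def)
  have rank: "rank (node s) = length s" if "s \<in> N" for s using that inj by (simp add: rank_def)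
  have rankN: "1 \<le> length s \<and> length s \<le> d" if "s \<in> N" for s
    using that label suffix_length_le by (fastforce simp: N_def Suc_le_eq)
  have VN: "label ` V \<subseteq> N" using label by (auto simp: N_def)
  have trancl: "(node s, node t) \<in> (parcs F)\<^sup>+" if "t \<in> N" "s \<noteq> []" "strict_suffix s t" for s t
    using that
  proof (induction t)
    case (Cons a t)
    \<comment> \<open>A strict suffix of \<open>a # t\<close> is \<open>t\<close>, the parent, or a
      strict suffix of \<open>t\<close>.\<close>
    have "suffix s t" using Cons.prems(3) by (auto simp: strict_suffix_def suffix_Cons)
    then have "t \<noteq> []" using \<open>s \<noteq> []\<close> by auto
    then have step: "(node t, node (a # t)) \<in> parcs F" and "t \<in> N"
      using Cons.prems(1) tlN[of "a # t"] by (force simp: F_def)+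
    show ?case
    proof (cases "s = t")
      case False
      then show ?thesis using Cons.IH \<open>t \<in> N\<close> \<open>s \<noteq> []\<close> \<open>suffix s t\<close> step
        by (auto simp: strict_suffix_def intro: trancl_into_trancl)
    qed (use step in auto)
  qed (simp add: strict_suffix_def)
  have "ranked_forest F rank d"
  proof
    show "finite (pverts F)" using \<open>finite N\<close> by (simp add: F_def)
    show "parcs F \<subseteq> pverts F \<times> pverts F" using tlN by (auto simp: F_def)
    show "rank u < rank v" if uv: "(u, v) \<in> parcs F" for u v
    proof -
      obtain s where s: "u = node (tl s)" "v = node s" "s \<in> N" "tl s \<noteq> []"
        using uv by (auto simp: F_def)
      then show ?thesis using tlN[of s] rank[of s] rank[of "tl s"] by (cases s) auto
    qed
    show "1 \<le> rank v \<and> rank v \<le> d" if "v \<in> pverts F" for v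
      using that rankN by (auto simp: F_def rank)
    show "u = v" if "(u, w) \<in> parcs F" "(v, w) \<in> parcs F" for u v w
      using that inj by (auto simp: F_def dest: inj_onD)
  qed
  moreover have "inj_on node (label ` V)" using inj VN by (rule inj_on_subset)
  moreover have "node ` label ` V \<subseteq> pverts F" using VN by (auto simp: F_def)
  ultimately show ?thesis using trancl VN label by blast
qed

section \<open>Embedding into a strong product\<close>

text \<open>Numbering each fibre separately gives the coordinate in the complete graph.\<close>

lemma ex_injective_on_fibres:
  assumes "finite V" and card: "\<And>l. card {v \<in> V. f v = l} \<le> m"
  shows "\<exists>idx :: 'a \<Rightarrow> nat. (\<forall>v\<in>V. idx v < m) \<and> inj_on (\<lambda>v. (f v, idx v)) V"
proof -
  have "\<exists>g :: 'a \<Rightarrow> nat. g ` {v \<in> V. f v = l} \<subseteq> {..<m} \<and> inj_on g {v \<in> V. f v = l}" for l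
    using assms by (intro card_le_inj) auto
  then obtain g :: "'b \<Rightarrow> 'a \<Rightarrow> nat" where
    g: "\<And>l. g l ` {v \<in> V. f v = l} \<subseteq> {..<m}" "\<And>l. inj_on (g l) {v \<in> V. f v = l}"
    by metis
  have "inj_on (\<lambda>v. (f v, g (f v) v)) V" using g(2) by (auto simp: inj_on_def)
  moreover have "\<forall>v\<in>V. g (f v) v < m" using g(1) by blast
  ultimately show ?thesis by (intro exI[of _ "\<lambda>v. g (f v) v"]) simp
qed

text \<open>The image of \<open>G\<close> under \<open>\<psi>\<close> is the required subgraph;
  injectivity on vertices carries over to arcs, which are pairs of vertices.\<close>

lemma contained_inI:
  assumes "pair_wf_digraph G" "pair_wf_digraph H" and inj: "inj_on \<psi> (pverts G)"
    and verts: "\<psi> ` pverts G \<subseteq> pverts H"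
    and arcs: "\<And>u v. (u, v) \<in> parcs G \<Longrightarrow> (\<psi> u, \<psi> v) \<in> parcs H"
  shows "contained_in G H"
proof -
  interpret G: pair_wf_digraph G by fact
  define G' where "G' = \<lparr> pverts = \<psi> ` pverts G, parcs = map_prod \<psi> \<psi> ` parcs G \<rparr>"
  define iso where "iso = \<lparr> iso_verts = \<psi>, iso_arcs = map_prod \<psi> \<psi>, iso_head = snd, iso_tail = fst \<rparr>"
  have "inj_on (map_prod \<psi> \<psi>) (parcs G)"
    using inj G.wellformed' by (auto simp: inj_on_def)
  then have "G.digraph_isomorphism iso"
    using inj G.wf_digraph_axioms by (auto simp: pre_digraph.digraph_isomorphism_def iso_def)
  moreover have "with_proj G' = app_iso iso (with_proj G)"
    by (simp add: app_iso_def iso_def G'_def with_proj_def)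
  ultimately have "digraph_iso (with_proj G) (with_proj G')" unfolding digraph_iso_def by blast
  moreover have "pair_wf_digraph G'" using G.wellformed' by unfold_locales (auto simp: G'_def)
  then have "subgraph (with_proj G') (with_proj H)"
    using verts arcs assms(2) by (intro subgraphI) (auto simp: G'_def wf_digraph_wp_iff)
  ultimately show ?thesis unfolding contained_in_def by blast
qed

text \<open>A vertex goes to the node of its label and its number within the fibre, and
  \<open>H\<close> is the closure of the forest of labels. Fibre sizes are integers, so the bound
  \<open>M\<close> may be rounded down.\<close>

lemma contained_in_strong_product_of_labelling:
  fixes label :: "'a \<Rightarrow> 'b list"
  assumes "pair_graph G" and lab: "tree_labelling (parcs G) (pverts G) d M label"
  shows "\<exists>(H :: nat pair_pre_digraph) (K :: nat pair_pre_digraph). pair_graph H \<and> tree_depth H \<le> d \<and>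
    complete_digraph (nat \<lfloor>M\<rfloor>) (with_proj K) \<and> contained_in G (strong_product H K)"
proof -
  interpret G: pair_graph G by fact
  define V where "V = pverts G"
  define m where "m = nat \<lfloor>M\<rfloor>"
  have fin: "finite V" using G.pair_finite_verts by (simp add: V_def)
  have label: "\<And>v. v \<in> V \<Longrightarrow> label v \<noteq> [] \<and> length (label v) \<le> d"
    and suf: "\<And>u v. (u, v) \<in> parcs G \<Longrightarrow> suffix (label u) (label v) \<or> suffix (label v) (label u)"
    and fibre: "\<And>l. card {v \<in> V. label v = l} \<le> m"
    using lab G.wellformed' by (auto simp: tree_labelling_def V_def m_def intro: le_nat_floor)
  obtain F :: "nat pair_pre_digraph" and rank node where F: "ranked_forest F rank d"
    and node: "inj_on node (label ` V)" "node ` label ` V \<subseteq> pverts F"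
    and anc: "\<And>u v. u \<in> V \<Longrightarrow> v \<in> V \<Longrightarrow> strict_suffix (label u) (label v) \<Longrightarrow>
      (node (label u), node (label v)) \<in> (parcs F)\<^sup>+"
    using ex_nat_forest_of_labelling[where V = V and label = label and d = d, OF fin label] by metis
  interpret ranked_forest F rank d by fact
  obtain idx :: "'a \<Rightarrow> nat" where idx: "\<And>v. v \<in> V \<Longrightarrow> idx v < m" 
    and inj: "inj_on (\<lambda>v. (label v, idx v)) V"
    using ex_injective_on_fibres[OF fin fibre] by blast
  define K where "K = \<lparr> pverts = {..<m}, parcs = {(x, y). x \<in> {..<m} \<and> y \<in> {..<m} \<and> x \<noteq> y} \<rparr>"
  define H where "H = forest_closure F"
  define \<psi> where "\<psi> v = (node (label v), idx v)" for v
  have node_eq: "node (label u) = node (label v) \<longleftrightarrow> label u = label v" if "u \<in> V" "v \<in> V" for u v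
    using inj_on_eq_iff[OF node(1)] that by auto
  have inj_\<psi>: "inj_on \<psi> V" using inj node_eq by (auto simp: inj_on_def \<psi>_def)
  have K: "complete_digraph m (with_proj K)" by (auto simp: complete_digraph_pair_def K_def)
  have \<psi>V: "\<psi> ` V \<subseteq> pverts (strong_product H K)"
    using node(2) idx by (auto simp: strong_product_def H_def K_def \<psi>_def forest_closure_def)
  have "contained_in G (strong_product H K)"
  proof (rule contained_inI)
    show "pair_wf_digraph G" ..
    show "pair_wf_digraph (strong_product H K)" by unfold_locales (auto simp: strong_product_def)
    show "inj_on \<psi> (pverts G)" "\<psi> ` pverts G \<subseteq> pverts (strong_product H K)"
      using inj_\<psi> \<psi>V by (simp_all add: V_def)
    fix u v assume uv: "(u, v) \<in> parcs G"
    then have V: "u \<in> V" "v \<in> V" using G.wellformed' by (auto simp: V_def)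
    \<comment> \<open>Distinct pairs that are equal or adjacent in each coordinate are adjacent in
      the product.\<close>
    have "\<psi> u \<noteq> \<psi> v" using inj_\<psi> V G.no_loops'[OF uv] by (auto dest: inj_onD)
    moreover have "idx u = idx v \<or> (idx u, idx v) \<in> parcs K" using idx V by (auto simp: K_def)
    moreover have "node (label u) = node (label v) \<or> (node (label u), node (label v)) \<in> parcs H"
      using suf[OF uv] anc V by (cases "label u = label v") (auto simp: H_def forest_closure_def strict_suffix_def)
    ultimately show "(\<psi> u, \<psi> v) \<in> parcs (strong_product H K)"
      using \<psi>V V by (fastforce simp: strong_product_def \<psi>_def)
  qed
  then show ?thesis
    using K pair_graph_closure tree_depth_closure unfolding m_def H_def by blast
qed

section \<open>From an integer number of levels to the bound in terms of \<open>h\<close>\<close>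

theorem theorem14:
  fixes \<epsilon> c :: real
    and h :: "nat \<Rightarrow> real"
    and \<G> :: "'a pair_pre_digraph set"
  assumes "0 < \<epsilon>" and "\<epsilon> < 1"
    and "filterlim h at_top sequentially"
    and "hereditary \<G>"
    and "0 < c"
    and "\<forall>G\<in>\<G>. real (sep G) \<le> c * real (card (pverts G)) powr (1 - \<epsilon>)"
  shows "\<forall>n. \<forall>G\<in>\<G>. card (pverts G) = n \<and> 0 < h n \<longrightarrow>
    (\<exists>(H :: nat pair_pre_digraph) (K :: nat pair_pre_digraph) m.
       pair_graph H \<and> int (tree_depth H) \<le> \<lceil>h n\<rceil> \<and>
       complete_digraph m (with_proj K) \<and>
       real m \<le> c * 2 powr \<epsilon> / (2 powr \<epsilon> - 1) * real n powr (1 - \<epsilon> + delta \<epsilon> h n) \<and>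
       contained_in G (strong_product H K))"
proof (intro allI ballI impI, elim conjE)
  fix n G assume G: "G \<in> \<G>" and n: "card (pverts G) = n" and h: "0 < h n"
  interpret separable "parcs G" "pverts G" \<epsilon> c
    by (rule separable_hereditary[OF assms(4) G assms(1,2,6)])
  have pG: "pair_graph G" by (rule hereditary_pair_graph[OF assms(4) G])
  define d where "d = nat \<lceil>h n\<rceil>"
  have d: "0 < d" "h n \<le> real d" "int d = \<lceil>h n\<rceil>" using h by (auto simp: d_def real_nat_ceiling_ge)
  define M where "M = B * real n powr ((1 - \<epsilon>) / (1 - \<epsilon> ^ d))"
  obtain label :: "'a \<Rightarrow> 'a set list" where "tree_labelling (parcs G) (pverts G) d M label"
    using ex_tree_labelling[OF d(1)] unfolding n M_def by blast
  then obtain H K :: "nat pair_pre_digraph" where HK: "pair_graph H" "tree_depth H \<le> d"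
    "complete_digraph (nat \<lfloor>M\<rfloor>) (with_proj K)" "contained_in G (strong_product H K)"
    using contained_in_strong_product_of_labelling[OF pG] by blast
  \<comment> \<open>The graph may be null, so the sign comes from \<open>0 < c\<close> instead of
    \<open>one_le_B\<close>.\<close>
  have B: "0 \<le> B" using assms(5) two_powr by simp
  have "real (nat \<lfloor>M\<rfloor>) \<le> M" unfolding M_def using B by (intro of_nat_floor mult_nonneg_nonneg) auto
  also have "M \<le> B * real n powr (1 - \<epsilon> + delta \<epsilon> h n)"
  \<comment> \<open>Monotonicity in the exponent needs a base of at least 1; for
    \<open>n = 0\<close> both sides are 0.\<close>
  proof (cases "n = 0")
    case False
    have "\<epsilon> powr h n < 1" using powr_less_mono'[of \<epsilon> 0 "h n"] h eps by simp
    \<comment> \<open>Rounding \<open>h n\<close> up to \<open>d\<close> lowers the power of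
      \<open>\<epsilon> < 1\<close>, and with it the exponent of \<open>n\<close>.\<close>
    moreover have "\<epsilon> ^ d \<le> \<epsilon> powr h n"
      using eps d(2) powr_mono'[of "h n" "real d" \<epsilon>] by (simp add: powr_realpow)
    ultimately have "(1 - \<epsilon>) / (1 - \<epsilon> ^ d) \<le> (1 - \<epsilon>) / (1 - \<epsilon> powr h n)"
      using eps by (intro divide_left_mono mult_pos_pos) auto
    also have "\<dots> = 1 - \<epsilon> + delta \<epsilon> h n" by (simp add: delta_def field_simps)
    finally show ?thesis
      unfolding M_def using False B by (intro mult_left_mono powr_mono) auto
  qed (simp add: M_def)
  finally show "\<exists>(H :: nat pair_pre_digraph) (K :: nat pair_pre_digraph) m.
       pair_graph H \<and> int (tree_depth H) \<le> \<lceil>h n\<rceil> \<and> complete_digraph m (with_proj K) \<and>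
       real m \<le> B * real n powr (1 - \<epsilon> + delta \<epsilon> h n) \<and> contained_in G (strong_product H K)"
    using HK d(3) by (intro exI[of _ H] exI[of _ K] exI[of _ "nat \<lfloor>M\<rfloor>"]) auto
qed

end
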